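(* Let $n,m\ge 1$, let $h:\mathbb{R}^n\to\mathbb{R}$ be a positively homogeneous function of degree $p\in\mathbb{R}$, and let $g_1,\ldots,g_m:\mathbb{R}^n\to\mathbb{R}$ be positively homogeneous functions of the same degree $0\neq d\in\mathbb{R}$. Assume that the set $\{\mathbf{x}:g_k(\mathbf{x})\le 1,\ k=1,\ldots,m\}$ is bounded. For $y>0$ let $\Omega(y):=\{\mathbf{x}\in\mathbb{R}^n: g_k(\mathbf{x})\le y,\ k=1,\ldots,m\}$, and let $\psi(\mathbf{x}):=\max[g_1(\mathbf{x}),\ldots,g_m(\mathbf{x})]$. Then for every $y>0$: $$\mathrm{vol}(\Omega(y))=\frac{y^{n/d}}{\Gamma(1+n/d)}\int_{\mathbb{R}^n}\exp(-\psi)\,d\mathbf{x},$$ and $$\int_{\Omega(y)}h(\mathbf{x})\,d\mathbf{x}=\frac{y^{(n+p)/d}}{\Gamma(1+(n+p)/d)}\int_{\mathbb{R}^n}h\exp(-\psi)\,d\mathbf{x},$$ the latter whenever $\int_{\mathbb{R}^n}|h|\exp(-\psi)\,d\mathbf{x}$ is finite.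
   Context: A continuous function $f:\mathbb{R}^n\to\mathbb{R}$ is positively homogeneous of degree $k\in\mathbb{R}$ if $f(\lambda\mathbf{x})=\lambda^k f(\mathbf{x})$ for all $\lambda>0$ and all $\mathbf{x}\in\mathbb{R}^n$. $\mathrm{vol}$ is Lebesgue measure on $\mathbb{R}^n$; $\Gamma$ is the standard Gamma function. *)

theory Defs
  imports "HOL-Analysis.Analysis"
begin

text \<open>Continuity is part of the notion. The degree is an arbitrary real number, hence \<open>powr\<close>,
  whose base is positive here.\<close>

definition pos_homogeneous :: "real \<Rightarrow> (real ^ 'n \<Rightarrow> real) \<Rightarrow> bool" where
  "pos_homogeneous k f \<longleftrightarrow>
     continuous_on UNIV f \<and> (\<forall>c>0. \<forall>x. f (c *\<^sub>R x) = c powr k * f x)"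

definition Omega :: "nat \<Rightarrow> (nat \<Rightarrow> real ^ 'n \<Rightarrow> real) \<Rightarrow> real \<Rightarrow> (real ^ 'n) set" where
  "Omega m g y = {x. \<forall>k\<in>{1..m}. g k x \<le> y}"

text \<open>Only meaningful for \<open>m \<ge> 1\<close>: for \<open>m = 0\<close> it is the unspecified maximum of the empty set.\<close>

definition psi :: "nat \<Rightarrow> (nat \<Rightarrow> real ^ 'n \<Rightarrow> real) \<Rightarrow> real ^ 'n \<Rightarrow> real" where
  "psi m g x = Max ((\<lambda>k. g k x) ` {1..m})"

end

theory Submission imports Defs begin

text \<open>Tonelli's theorem applied to \<open>exp (- \<psi> x) = \<integral>\<^bsub>\<psi> x\<^esub>\<^bsup>\<infinity>\<^esup> exp (- t) dt\<close> turns the integral of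
  \<open>h exp (- \<psi>)\<close> into that of \<open>exp (- t)\<close> times the integral of \<open>h\<close> over \<open>\<Omega>(t)\<close>. By scaling, the latter is
  \<open>t\<^bsup>(n + p) / d\<^esup>\<close> times the integral of \<open>h\<close> over \<open>\<Omega>(1)\<close>, so a Gamma integral remains. Tonelli asks for
  \<open>\<psi> \<ge> 0\<close>, which boundedness forces: where \<open>\<psi>\<close> is negative, \<open>\<Omega>(1)\<close> contains a ray. Negative
  degrees are degenerate, since continuity at the origin makes such functions vanish; hence \<open>d > 0\<close>,
  and \<open>h = 0\<close> if \<open>p < 0\<close>.\<close>

lemma nn_integral_lborel_scaleR:
  fixes f :: "'a::euclidean_space \<Rightarrow> ennreal"
  assumes [measurable]: "f \<in> borel_measurable borel" and "c > 0"
  shows "(\<integral>\<^sup>+x. f x \<partial>lborel) = ennreal (c ^ DIM('a)) * (\<integral>\<^sup>+x. f (c *\<^sub>R x) \<partial>lborel)"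
  using \<open>c > 0\<close>
  by (subst lborel_affine[of c 0])
     (simp_all add: nn_integral_density nn_integral_distr nn_integral_cmult)

lemma nn_integral_exp_minus_atLeast:
  fixes a :: real
  shows "(\<integral>\<^sup>+t. ennreal (exp (- t)) * indicator {a..} t \<partial>lborel) = ennreal (exp (- a))"
proof -
  have "((\<lambda>t::real. - exp (- t)) \<longlongrightarrow> - 0) at_top"
    by (intro tendsto_minus filterlim_compose[OF exp_at_bot] filterlim_uminus_at_bot_at_top)
  then have "(\<integral>\<^sup>+t. ennreal (exp (- t)) * indicator {a..} t \<partial>lborel) = ennreal (- 0 - (- exp (- a)))"
    by (intro nn_integral_FTC_atLeast) (auto intro!: derivative_eq_intros)
  then show ?thesis by simp
qed

text \<open>Dilation by \<open>c = t powr (1 / d)\<close> carries the sublevel set at level 1 onto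
  the one at level \<open>t\<close>. The Jacobian contributes \<open>c ^ DIM('a)\<close> and the
  homogeneity of \<open>u\<close> contributes \<open>c powr p\<close>, which together form the
  stated power of \<open>t\<close>.\<close>

lemma nn_integral_homogeneous_sublevel:
  fixes f u :: "'a::euclidean_space \<Rightarrow> real"
  assumes [measurable]: "f \<in> borel_measurable borel" "u \<in> borel_measurable borel"
    and f: "\<And>c x. c > 0 \<Longrightarrow> f (c *\<^sub>R x) = c powr d * f x"
    and u: "\<And>c x. c > 0 \<Longrightarrow> u (c *\<^sub>R x) = c powr p * u x"
    and "d \<noteq> 0" "t > 0"
  shows "(\<integral>\<^sup>+x. ennreal (u x) * indicator {x. f x \<le> t} x \<partial>lborel) =
    ennreal (t powr ((real DIM('a) + p) / d)) * (\<integral>\<^sup>+x. ennreal (u x) * indicator {x. f x \<le> 1} x \<partial>lborel)"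
proof -
  define c where "c = t powr (1 / d)"
  have c: "c > 0" "c powr d = t"
    using assms by (auto simp: c_def powr_powr)
  have "c ^ DIM('a) * c powr p = c powr (real DIM('a) + p)"
    using c by (simp add: powr_add powr_realpow)
  also have "\<dots> = t powr ((real DIM('a) + p) / d)"
    by (simp add: c_def powr_powr)
  finally have *: "ennreal (t powr ((real DIM('a) + p) / d)) = ennreal (c ^ DIM('a)) * ennreal (c powr p)"
    using c by (simp flip: ennreal_mult)
  have "(\<integral>\<^sup>+x. ennreal (u x) * indicator {x. f x \<le> t} x \<partial>lborel) =
    ennreal (c ^ DIM('a)) * (\<integral>\<^sup>+x. ennreal (u (c *\<^sub>R x)) * indicator {x. f x \<le> t} (c *\<^sub>R x) \<partial>lborel)"
    by (rule nn_integral_lborel_scaleR) (use c in auto)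
  \<comment> \<open>By the choice of \<open>c\<close>, \<open>f (c *\<^sub>R x) = t * f x\<close>,
    so level \<open>t\<close> becomes level 1. The sign of \<open>u\<close> does not matter:
    \<open>ennreal\<close> truncates negative values to 0, and this commutes with the nonnegative
    factor \<open>c powr p\<close>.\<close>
  also have "(\<lambda>x. ennreal (u (c *\<^sub>R x)) * indicator {x. f x \<le> t} (c *\<^sub>R x)) =
      (\<lambda>x. ennreal (c powr p) * (ennreal (u x) * indicator {x. f x \<le> 1} x))"
    using c \<open>t > 0\<close> by (auto simp: fun_eq_iff f u ennreal_mult' indicator_def)
  finally show ?thesis
    by (simp add: nn_integral_cmult * mult.assoc)
qed

text \<open>Exchanging the integrals over \<open>x\<close> and \<open>t\<close> leaves Euler's
  integral for \<open>Gamma\<close> in \<open>t\<close>, which converges by \<open>pos\<close>. The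
  identity lives in \<open>ennreal\<close>, so both sides may be infinite.\<close>

lemma nn_integral_homogeneous_exp:
  fixes f u :: "'a::euclidean_space \<Rightarrow> real"
  assumes [measurable]: "f \<in> borel_measurable borel" "u \<in> borel_measurable borel"
    and f: "\<And>c x. c > 0 \<Longrightarrow> f (c *\<^sub>R x) = c powr d * f x"
    and u: "\<And>c x. c > 0 \<Longrightarrow> u (c *\<^sub>R x) = c powr p * u x"
    and nonneg: "\<And>x. f x \<ge> 0"
    and d: "d \<noteq> 0" and pos: "1 + (real DIM('a) + p) / d > 0"
  shows "(\<integral>\<^sup>+x. ennreal (u x) * ennreal (exp (- f x)) \<partial>lborel) =
    ennreal (Gamma (1 + (real DIM('a) + p) / d)) * (\<integral>\<^sup>+x. ennreal (u x) * indicator {x. f x \<le> 1} x \<partial>lborel)"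
    (is "_ = ennreal (Gamma (1 + ?a)) * ?I")
proof -
  have "(\<integral>\<^sup>+x. ennreal (u x) * ennreal (exp (- f x)) \<partial>lborel) =
    (\<integral>\<^sup>+x. (\<integral>\<^sup>+t. ennreal (u x) * (ennreal (exp (- t)) * indicator {f x..} t) \<partial>lborel) \<partial>lborel)"
    by (simp add: nn_integral_cmult nn_integral_exp_minus_atLeast)
  \<comment> \<open>Written as a condition on the pair rather than as an indicator of a set
    depending on \<open>x\<close>, the integrand is visibly jointly measurable, as the exchange
    requires.\<close>
  also have "\<dots> = (\<integral>\<^sup>+x. (\<integral>\<^sup>+t. ennreal (u x) * (ennreal (exp (- t)) * (if f x \<le> t then 1 else 0)) \<partial>lborel) \<partial>lborel)"
    by (intro nn_integral_cong) (auto simp: indicator_def)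
  also have "\<dots> = (\<integral>\<^sup>+t. (\<integral>\<^sup>+x. ennreal (u x) * (ennreal (exp (- t)) * (if f x \<le> t then 1 else 0)) \<partial>lborel) \<partial>lborel)"
    by (rule lborel_pair.Fubini'[symmetric]) measurable
  \<comment> \<open>The exponent stays in the form \<open>1 + ?a - 1\<close> to match Euler's
    integral at \<open>1 + ?a\<close>. The point \<open>t = 0\<close>, where scaling says nothing,
    is discarded as a null set.\<close>
  also have "\<dots> = (\<integral>\<^sup>+t. ennreal (indicator {0..} t * t powr (1 + ?a - 1) / exp t) * ?I \<partial>lborel)"
  proof (rule nn_integral_cong_AE, rule AE_mp[OF AE_lborel_singleton[of 0]], rule AE_I2, rule impI)
    fix t :: real assume "t \<noteq> 0"
    have "(\<integral>\<^sup>+x. ennreal (u x) * (ennreal (exp (- t)) * (if f x \<le> t then 1 else 0)) \<partial>lborel) =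
        (\<integral>\<^sup>+x. ennreal (exp (- t)) * (ennreal (u x) * indicator {x. f x \<le> t} x) \<partial>lborel)"
      by (intro nn_integral_cong) (auto simp: indicator_def mult_ac)
    also have "\<dots> = ennreal (exp (- t)) * (\<integral>\<^sup>+x. ennreal (u x) * indicator {x. f x \<le> t} x \<partial>lborel)"
      by (rule nn_integral_cmult) measurable
    also have "\<dots> = ennreal (indicator {0..} t * t powr (1 + ?a - 1) / exp t) * ?I"
    proof (cases "t > 0")
      case True
      show ?thesis
        using True
        by (subst nn_integral_homogeneous_sublevel[OF assms(1-4) d True])
           (simp_all add: exp_minus field_simps flip: mult.assoc ennreal_mult)
    next
      \<comment> \<open>Here \<open>t < 0\<close>: the sublevel set is empty because
        \<open>f\<close> is nonnegative, and the factor \<open>indicator {0..} t\<close> vanishes on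
        the other side.\<close>
      case False
      then have "\<not> f x \<le> t" for x using nonneg[of x] \<open>t \<noteq> 0\<close> by auto
      then show ?thesis using False \<open>t \<noteq> 0\<close> by simp
    qed
    finally show "(\<integral>\<^sup>+x. ennreal (u x) * (ennreal (exp (- t)) * (if f x \<le> t then 1 else 0)) \<partial>lborel) =
        ennreal (indicator {0..} t * t powr (1 + ?a - 1) / exp t) * ?I" .
  qed
  also have "\<dots> = ennreal (Gamma (1 + ?a)) * ?I"
    using Gamma_conv_nn_integral_real[OF pos] by (simp add: nn_integral_multc)
  finally show ?thesis .
qed

text \<open>For nonnegative \<open>u\<close> the extended integrals are finite multiples of the one
  over the unit sublevel set, so its integrability carries over to the other two.\<close>

lemma has_bochner_integral_homogeneous_nonneg:
  fixes f u :: "'a::euclidean_space \<Rightarrow> real"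
  assumes [measurable]: "f \<in> borel_measurable borel" "u \<in> borel_measurable borel"
    and f: "\<And>c x. c > 0 \<Longrightarrow> f (c *\<^sub>R x) = c powr d * f x"
    and u: "\<And>c x. c > 0 \<Longrightarrow> u (c *\<^sub>R x) = c powr p * u x"
    and nonneg: "\<And>x. f x \<ge> 0" "\<And>x. u x \<ge> 0"
    and d: "d \<noteq> 0" and pos: "1 + (real DIM('a) + p) / d > 0" and t: "t > 0"
    and I: "has_bochner_integral lborel (\<lambda>x. indicator {x. f x \<le> 1} x * u x) I"
  shows "has_bochner_integral lborel (\<lambda>x. indicator {x. f x \<le> t} x * u x)
           (t powr ((real DIM('a) + p) / d) * I)"
    and "has_bochner_integral lborel (\<lambda>x. u x * exp (- f x)) (Gamma (1 + (real DIM('a) + p) / d) * I)"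
proof -
  have I0: "I \<ge> 0"
    using I nonneg by (auto simp: has_bochner_integral_iff intro!: integral_nonneg_AE)
  have ind: "ennreal (indicator {x. f x \<le> s} x * u x) = ennreal (u x) * indicator {x. f x \<le> s} x" for s x
    by (auto simp: indicator_def)
  have I': "(\<integral>\<^sup>+x. ennreal (u x) * indicator {x. f x \<le> 1} x \<partial>lborel) = ennreal I"
    using nn_integral_eq_integral[of lborel "\<lambda>x. indicator {x. f x \<le> 1} x * u x"] I nonneg
    by (simp add: has_bochner_integral_iff ind)
  show "has_bochner_integral lborel (\<lambda>x. indicator {x. f x \<le> t} x * u x)
           (t powr ((real DIM('a) + p) / d) * I)"
    using nn_integral_homogeneous_sublevel[OF assms(1-4) d t] nonneg I0
    by (intro has_bochner_integral_nn_integral) (auto simp: ind I' ennreal_mult)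
  show "has_bochner_integral lborel (\<lambda>x. u x * exp (- f x)) (Gamma (1 + (real DIM('a) + p) / d) * I)"
    using nn_integral_homogeneous_exp[OF assms(1-4) nonneg(1) d pos] nonneg I0 Gamma_real_pos[OF pos]
    by (intro has_bochner_integral_nn_integral) (auto simp: I' ennreal_mult)
qed

text \<open>The positive and negative parts of \<open>u\<close> are again homogeneous of degree
  \<open>p\<close>, because \<open>c powr p\<close> is positive. The nonnegative case applies to
  each, and the results are subtracted.\<close>

lemma has_bochner_integral_homogeneous:
  fixes f u :: "'a::euclidean_space \<Rightarrow> real"
  assumes [measurable]: "f \<in> borel_measurable borel" "u \<in> borel_measurable borel"
    and f: "\<And>c x. c > 0 \<Longrightarrow> f (c *\<^sub>R x) = c powr d * f x"
    and u: "\<And>c x. c > 0 \<Longrightarrow> u (c *\<^sub>R x) = c powr p * u x"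
    and nonneg: "\<And>x. f x \<ge> 0"
    and d: "d \<noteq> 0" and pos: "1 + (real DIM('a) + p) / d > 0" and t: "t > 0"
    and I: "has_bochner_integral lborel (\<lambda>x. indicator {x. f x \<le> 1} x * u x) I"
  shows "has_bochner_integral lborel (\<lambda>x. indicator {x. f x \<le> t} x * u x)
           (t powr ((real DIM('a) + p) / d) * I)"
    and "has_bochner_integral lborel (\<lambda>x. u x * exp (- f x)) (Gamma (1 + (real DIM('a) + p) / d) * I)"
proof -
  have int: "integrable lborel (\<lambda>x. indicator {x. f x \<le> 1} x * u x)"
    using I by (simp add: has_bochner_integral_iff)
  have p': "has_bochner_integral lborel (\<lambda>x. indicator {x. f x \<le> 1} x * max 0 (u x))
      (LINT x|lborel. indicator {x. f x \<le> 1} x * max 0 (u x))" (is "has_bochner_integral _ _ ?P")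
    by (intro has_bochner_integral_integrable Bochner_Integration.integrable_bound[OF int])
       (auto simp: indicator_def)
  have n': "has_bochner_integral lborel (\<lambda>x. indicator {x. f x \<le> 1} x * max 0 (- u x))
      (LINT x|lborel. indicator {x. f x \<le> 1} x * max 0 (- u x))" (is "has_bochner_integral _ _ ?N")
    by (intro has_bochner_integral_integrable Bochner_Integration.integrable_bound[OF int])
       (auto simp: indicator_def)
  \<comment> \<open>Both orders of the product are provided: the weight stands on the left in the
    sublevel integral and on the right in the exponential one.\<close>
  have split: "w * u x = w * max 0 (u x) - w * max 0 (- u x)"
      "u x * w = max 0 (u x) * w - max 0 (- u x) * w" for w x
    by (auto simp: max_def)
  have hom: "max 0 (u (c *\<^sub>R x)) = c powr p * max 0 (u x)"
    "max 0 (- u (c *\<^sub>R x)) = c powr p * max 0 (- u x)" if "c > 0" for c x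
    using that by (auto simp: u max_def mult_le_0_iff zero_le_mult_iff)
  have IPN: "I = ?P - ?N"
    using has_bochner_integral_eq[OF I] has_bochner_integral_diff[OF p' n']
    by (simp flip: split)
  note P = has_bochner_integral_homogeneous_nonneg[OF assms(1) _ f hom(1) nonneg _ d pos t p']
  note N = has_bochner_integral_homogeneous_nonneg[OF assms(1) _ f hom(2) nonneg _ d pos t n']
  show "has_bochner_integral lborel (\<lambda>x. indicator {x. f x \<le> t} x * u x)
           (t powr ((real DIM('a) + p) / d) * I)"
    unfolding IPN right_diff_distrib
    by (subst split(1), intro has_bochner_integral_diff P N) (simp_all, measurable)
  show "has_bochner_integral lborel (\<lambda>x. u x * exp (- f x)) (Gamma (1 + (real DIM('a) + p) / d) * I)"
    unfolding IPN right_diff_distrib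
    by (subst split(2), intro has_bochner_integral_diff P N) (simp_all, measurable)
qed

text \<open>Doubling fixes the origin but multiplies the value there by \<open>2 powr k\<close>,
  which differs from 1.\<close>

lemma pos_homogeneous_zero:
  assumes "pos_homogeneous k f" "k \<noteq> 0"
  shows "f 0 = 0"
proof -
  have "f (2 *\<^sub>R 0) = 2 powr k * f 0"
    using assms(1) unfolding pos_homogeneous_def by (metis zero_less_numeral)
  then show ?thesis using \<open>k \<noteq> 0\<close> by simp
qed

text \<open>The product \<open>c powr (- k) * f (c *\<^sub>R x)\<close> is constantly
  \<open>f x\<close> for \<open>c > 0\<close>. As \<open>c\<close> decreases to 0, its first factor
  tends to 0 and its second to the finite value \<open>f 0\<close>.\<close>

lemma pos_homogeneous_neg_degree:
  fixes f :: "real ^ 'n \<Rightarrow> real"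
  assumes f: "pos_homogeneous k f" and "k < 0"
  shows "f x = 0"
proof -
  have "isCont f 0"
    using f by (auto simp: pos_homogeneous_def continuous_on_eq_continuous_at)
  moreover have "((\<lambda>c. c *\<^sub>R x) \<longlongrightarrow> 0 *\<^sub>R x) (at_right 0)"
    by (intro tendsto_intros)
  ultimately have "((\<lambda>c. f (c *\<^sub>R x)) \<longlongrightarrow> f 0) (at_right 0)"
    by (intro isCont_tendsto_compose[of 0 f]) auto
  moreover have "((\<lambda>c. c powr (- k)) \<longlongrightarrow> 0) (at_right 0)"
    using \<open>k < 0\<close> by (auto intro!: tendsto_eq_intros simp: eventually_at_filter)
  ultimately have "((\<lambda>c. c powr (- k) * f (c *\<^sub>R x)) \<longlongrightarrow> 0 * f 0) (at_right 0)"
    by (intro tendsto_mult)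
  moreover have "\<forall>\<^sub>F c in at_right 0. c powr (- k) * f (c *\<^sub>R x) = f x"
    using f by (auto simp: pos_homogeneous_def eventually_at_filter powr_minus)
  ultimately have "((\<lambda>c::real. f x) \<longlongrightarrow> 0) (at_right 0)"
    by (simp cong: filterlim_cong)
  then show ?thesis
    by (simp add: tendsto_const_iff)
qed

lemma not_bounded_ray:
  fixes x :: "'a::real_normed_vector"
  assumes "x \<noteq> 0" "\<And>c. c > 0 \<Longrightarrow> c *\<^sub>R x \<in> S"
  shows "\<not> bounded S"
proof
  assume "bounded S"
  then obtain B where B: "B > 0" "\<And>z. z \<in> S \<Longrightarrow> norm z \<le> B"
    unfolding bounded_pos by blast
  have "((B + 1) / norm x) *\<^sub>R x \<in> S"
    using B \<open>x \<noteq> 0\<close> by (intro assms(2)) simp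
  then have "norm (((B + 1) / norm x) *\<^sub>R x) \<le> B"
    by (rule B(2))
  then show False using B \<open>x \<noteq> 0\<close> by simp
qed

theorem corollary2p3:
  fixes h :: "real ^ 'n \<Rightarrow> real"
    and g :: "nat \<Rightarrow> real ^ 'n \<Rightarrow> real"
    and m :: nat and p d y :: real
  assumes "m \<ge> 1"
    and "pos_homogeneous p h"
    and "\<And>k. k \<in> {1..m} \<Longrightarrow> pos_homogeneous d (g k)"
    and "d \<noteq> 0"
    and "bounded {x. \<forall>k\<in>{1..m}. g k x \<le> 1}"
    and "y > 0"
  shows "(Omega m g y \<in> fmeasurable lebesgue \<and>
          integrable lebesgue (\<lambda>x. exp (- psi m g x)) \<and>
          measure lebesgue (Omega m g y) =
            y powr (real CARD('n) / d) / Gamma (1 + real CARD('n) / d)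
              * (LINT x|lebesgue. exp (- psi m g x))) \<and>
         ((\<integral>\<^sup>+x. ennreal (\<bar>h x\<bar> * exp (- psi m g x)) \<partial>lebesgue) < \<infinity> \<longrightarrow>
          set_integrable lebesgue (Omega m g y) h \<and>
          integrable lebesgue (\<lambda>x. h x * exp (- psi m g x)) \<and>
          (LINT x:Omega m g y|lebesgue. h x) =
            y powr ((real CARD('n) + p) / d) / Gamma (1 + (real CARD('n) + p) / d)
              * (LINT x|lebesgue. h x * exp (- psi m g x)))"
proof -
  let ?f = "psi m g"
  have ne: "{1..m} \<noteq> {}" using \<open>m \<ge> 1\<close> by simp
  have cont: "continuous_on UNIV (g k)" if "k \<in> {1..m}" for k
    using assms(3)[OF that] by (simp add: pos_homogeneous_def)
  have ghom: "g k (c *\<^sub>R x) = c powr d * g k x" if "k \<in> {1..m}" "c > 0" for k c x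
    using assms(3)[OF that(1)] that(2) by (simp add: pos_homogeneous_def)
  have conth: "continuous_on UNIV h" and hhom: "\<And>c x. c > 0 \<Longrightarrow> h (c *\<^sub>R x) = c powr p * h x"
    using assms(2) by (auto simp: pos_homogeneous_def)
  have Omega_psi: "Omega m g t = {x. ?f x \<le> t}" for t
    using ne by (auto simp: Omega_def psi_def)
  have [measurable]: "?f \<in> borel_measurable borel"
    unfolding psi_def using cont by (intro borel_measurable_Max borel_measurable_continuous_onI) auto
  have [measurable]: "h \<in> borel_measurable borel"
    using conth by (rule borel_measurable_continuous_onI)
  have fhom: "?f (c *\<^sub>R x) = c powr d * ?f x" if "c > 0" for c x
  proof -
    have "(\<lambda>k. g k (c *\<^sub>R x)) ` {1..m} = (\<lambda>z. c powr d * z) ` (\<lambda>k. g k x) ` {1..m}"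
      using that by (auto simp: ghom image_image)
    moreover have "mono (\<lambda>z. c powr d * z)"
      by (intro monoI mult_left_mono) auto
    ultimately show ?thesis
      using ne by (simp add: psi_def mono_Max_commute)
  qed
  have "d > 0"
  proof (rule ccontr)
    assume "\<not> d > 0"
    then have "d < 0" using \<open>d \<noteq> 0\<close> by simp
    then have "{x. \<forall>k\<in>{1..m}. g k x \<le> 1} = UNIV"
      using pos_homogeneous_neg_degree[OF assms(3)] by auto
    then show False using assms(5) by (simp add: not_bounded_UNIV)
  qed
  have nonneg: "?f x \<ge> 0" for x
  proof (rule ccontr)
    assume neg: "\<not> ?f x \<ge> 0"
    \<comment> \<open>A ray needs a nonzero direction, so the origin must be ruled out as a point
      where \<open>?f\<close> is negative.\<close>
    have "?f 0 = 0"
      using ne pos_homogeneous_zero[OF assms(3) \<open>d \<noteq> 0\<close>] by (simp add: psi_def)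
    then have "x \<noteq> 0" using neg by auto
    moreover have "c *\<^sub>R x \<in> Omega m g 1" if "c > 0" for c
    proof -
      have "c powr d * ?f x \<le> 0" using neg by (simp add: mult_le_0_iff)
      then show ?thesis using that by (simp add: Omega_psi fhom)
    qed
    ultimately have "\<not> bounded (Omega m g 1)"
      by (rule not_bounded_ray)
    then show False using assms(5) by (simp add: Omega_def)
  qed
  have "closed (Omega m g 1)"
  proof -
    have "closed (\<Inter>k\<in>{1..m}. {x. g k x \<le> 1})"
      using cont by (intro closed_INT ballI closed_Collect_le continuous_intros) auto
    moreover have "Omega m g 1 = (\<Inter>k\<in>{1..m}. {x. g k x \<le> 1})"
      by (auto simp: Omega_def)
    ultimately show ?thesis by simp
  qed
  then have compact: "compact (Omega m g 1)"
    using assms(5) by (simp add: compact_eq_bounded_closed Omega_def)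
  \<comment> \<open>A general integrand \<open>u\<close> serves both claims: the constant 1 with
    \<open>q = 0\<close> gives the volume, and \<open>h\<close> gives the second formula.
    Compactness of \<open>Omega m g 1\<close> makes the continuous \<open>u\<close> integrable
    there, and \<open>q \<ge> 0\<close> keeps the argument of \<open>Gamma\<close> positive.\<close>
  have main: "has_bochner_integral lebesgue (\<lambda>x. indicator (Omega m g y) x * u x)
        (y powr ((real CARD('n) + q) / d) * (LINT x:Omega m g 1|lborel. u x))"
      "has_bochner_integral lebesgue (\<lambda>x. u x * exp (- ?f x))
        (Gamma (1 + (real CARD('n) + q) / d) * (LINT x:Omega m g 1|lborel. u x))"
    if u: "continuous_on UNIV u" "\<And>c x. c > 0 \<Longrightarrow> u (c *\<^sub>R x) = c powr q * u x" and q: "q \<ge> 0" for u q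
  proof -
    have [measurable]: "u \<in> borel_measurable borel"
      using u(1) by (rule borel_measurable_continuous_onI)
    have "set_integrable lborel (Omega m g 1) u"
      unfolding set_integrable_def
      by (rule borel_integrable_compact[OF compact]) (rule continuous_on_subset[OF u(1)], simp)
    then have "has_bochner_integral lborel (\<lambda>x. indicator {x. ?f x \<le> 1} x * u x) (LINT x:Omega m g 1|lborel. u x)"
      by (simp add: has_bochner_integral_iff set_integrable_def set_lebesgue_integral_def Omega_psi)
    moreover have "1 + (real DIM(real ^ 'n) + q) / d > 0"
      using q \<open>d > 0\<close> by (intro add_pos_nonneg divide_nonneg_pos) auto
    ultimately have *: "has_bochner_integral lborel (\<lambda>x. indicator {x. ?f x \<le> y} x * u x)
        (y powr ((real CARD('n) + q) / d) * (LINT x:Omega m g 1|lborel. u x))"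
      "has_bochner_integral lborel (\<lambda>x. u x * exp (- ?f x))
        (Gamma (1 + (real CARD('n) + q) / d) * (LINT x:Omega m g 1|lborel. u x))"
      using has_bochner_integral_homogeneous[OF _ _ fhom u(2) nonneg \<open>d \<noteq> 0\<close> _ \<open>y > 0\<close>]
      by simp_all
    show "has_bochner_integral lebesgue (\<lambda>x. indicator (Omega m g y) x * u x)
        (y powr ((real CARD('n) + q) / d) * (LINT x:Omega m g 1|lborel. u x))"
      \<comment> \<open>Lebesgue measure is the completion of \<open>lborel\<close>, and Borel
        measurable integrands keep their integrals under completion.\<close>
      using *(1) by (simp add: has_bochner_integral_iff integrable_completion integral_completion Omega_psi)
    show "has_bochner_integral lebesgue (\<lambda>x. u x * exp (- ?f x))
        (Gamma (1 + (real CARD('n) + q) / d) * (LINT x:Omega m g 1|lborel. u x))"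
      using *(2) by (simp add: has_bochner_integral_iff integrable_completion integral_completion)
  qed
  \<comment> \<open>Eliminating the common integral over \<open>Omega m g 1\<close> from the two
    parts of \<open>main\<close> means dividing by this value.\<close>
  have Gpos: "Gamma (1 + (real CARD('n) + q) / d) > 0" if "q \<ge> 0" for q
    using that \<open>d > 0\<close> by (intro Gamma_real_pos add_pos_nonneg divide_nonneg_pos) auto
  have meas: "Omega m g y \<in> sets lebesgue"
    unfolding Omega_psi by (intro sets_completionI_sets) simp
  note one = main[where u = "\<lambda>_. 1" and q = 0, simplified]
  show ?thesis
  proof (intro conjI impI)
    have int: "integrable lebesgue (indicator (Omega m g y) :: _ \<Rightarrow> real)"
      using one(1) by (simp add: has_bochner_integral_iff)
    then show "Omega m g y \<in> fmeasurable lebesgue"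
      using meas by (simp add: fmeasurable_def integrable_indicator_iff)
    show "integrable lebesgue (\<lambda>x. exp (- ?f x))"
      using one(2) by (simp add: has_bochner_integral_iff)
    show "measure lebesgue (Omega m g y) =
            y powr (real CARD('n) / d) / Gamma (1 + real CARD('n) / d)
              * (LINT x|lebesgue. exp (- psi m g x))"
      using one Gpos[of 0] by (simp add: has_bochner_integral_iff)
  next
    have "set_integrable lebesgue (Omega m g y) h \<and>
          integrable lebesgue (\<lambda>x. h x * exp (- psi m g x)) \<and>
          (LINT x:Omega m g y|lebesgue. h x) =
            y powr ((real CARD('n) + p) / d) / Gamma (1 + (real CARD('n) + p) / d)
              * (LINT x|lebesgue. h x * exp (- psi m g x))"
    proof (cases "p \<ge> 0")
      case True
      show ?thesis
        using main[OF conth hhom True] Gpos[OF True]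
        by (simp add: has_bochner_integral_iff set_integrable_def set_lebesgue_integral_def)
    next
      \<comment> \<open>For negative \<open>p\<close> the argument of \<open>Gamma\<close> may even
        be a pole. Since \<open>h\<close> vanishes identically, both integrals are 0 and the
        identity holds whatever the quotient in front is.\<close>
      case False
      then have "h = (\<lambda>_. 0)"
        using pos_homogeneous_neg_degree[OF assms(2)] by auto
      then show ?thesis
        by (simp add: set_integrable_def set_lebesgue_integral_def)
    qed
    then show "set_integrable lebesgue (Omega m g y) h"
      "integrable lebesgue (\<lambda>x. h x * exp (- psi m g x))"
      "(LINT x:Omega m g y|lebesgue. h x) =
            y powr ((real CARD('n) + p) / d) / Gamma (1 + (real CARD('n) + p) / d)
              * (LINT x|lebesgue. h x * exp (- psi m g x))"
      by auto
  qed
qed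

end
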